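(* Let $G$ be a locally compact, $\sigma$-compact group, and let $c\geq 1$. If $G$ has Property (FH)$_c$, then it has Property (T)$_c$.
   Context: For $c\ge 1$, $\mathcal{R}_c(G)$ is the class of all strongly continuous homomorphisms $\pi$ from $G$ to the invertible bounded operators on a Hilbert space $\mathcal{H}_\pi$ with $|\pi|=\sup_{s\in G}\|\pi(s)\|\le c$. A representation $\pi$ almost has invariant vectors if for every compact $Q\subset G$ and every $\varepsilon>0$ there is $\xi\in\mathcal{H}_\pi$ with $\sup_{s\in Q}\|\pi(s)\xi-\xi\|<\varepsilon\|\xi\|$. $G$ has Property (T)$_c$ if every $\pi\in\mathcal{R}_c(G)$ that almost has invariant vectors has a nonzero invariant vector. A (continuous) affine action of $G$ on a Hilbert space $\mathcal{H}$ with linear part $\pi$ is an action $\sigma(s)x=\pi(s)x+b(s)$, where $\pi$ is a strongly continuous representation of $G$ on $\mathcal{H}$ and $b:G\to\mathcal{H}$ is norm-continuous with $b(st)=\pi(s)b(t)+b(s)$ for all $s,t\in G$. $G$ has Property (FH)$_c$ if every affine action of $G$ on a Hilbert space whose linear part belongs to $\mathcal{R}_c(G)$ has a fixed point. *)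

theory Defs
  imports "HOL-Analysis.Analysis" "HOL-Algebra.Module"
begin

section \<open>Topological groups\<close>

locale topological_group = group G for G (structure) and T :: "'g topology" +
  assumes topspace_eq: "topspace T = carrier G"
    and continuous_mult: "continuous_map (prod_topology T T) T (\<lambda>(x, y). x \<otimes> y)"
    and continuous_inv: "continuous_map T T (\<lambda>x. inv x)"

text \<open>As usual, locally compact groups are understood to be Hausdorff.\<close>

locale locally_compact_group = topological_group +
  assumes locally_compact: "locally_compact_space T"
    and Hausdorff: "Hausdorff_space T"

definition sigma_compact_space :: "'g topology \<Rightarrow> bool" where
  "sigma_compact_space T \<longleftrightarrow>
    (\<exists>K :: nat \<Rightarrow> 'g set. (\<forall>n. compactin T (K n)) \<and> (\<Union>n. K n) = topspace T)"


section \<open>Complex Hilbert spaces with explicit carriers\<close>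

text \<open>
  Spaces are objects rather than types, so that one can quantify over them inside a formula.
  The fields \<open>mult\<close> and \<open>one\<close> that \<^type>\<open>module\<close> inherits from rings play no role.
\<close>

definition complex_scalars :: "complex ring" where
  "complex_scalars = \<lparr>carrier = UNIV, mult = (*), one = 1, zero = 0, add = (+)\<rparr>"

record 'h hilbert = "(complex, 'h) module" +
  hinner :: "'h \<Rightarrow> 'h \<Rightarrow> complex"

definition hnorm :: "'h hilbert \<Rightarrow> 'h \<Rightarrow> real" where
  "hnorm H x = sqrt (Re (hinner H x x))"

text \<open>The value 0 off the carrier is needed because \<^locale>\<open>Metric_space\<close> asks for
  symmetry and nonnegativity of the distance on the whole type.\<close>

definition hdist :: "'h hilbert \<Rightarrow> 'h \<Rightarrow> 'h \<Rightarrow> real" where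
  "hdist H x y =
    (if x \<in> carrier H \<and> y \<in> carrier H then hnorm H (x \<ominus>\<^bsub>H\<^esub> y) else 0)"

abbreviation htopology :: "'h hilbert \<Rightarrow> 'h topology" where
  "htopology H \<equiv> Metric_space.mtopology (carrier H) (hdist H)"

locale complex_inner_space = Module.module complex_scalars H for H :: "'h hilbert" (structure) +
  assumes hinner_add_left: "\<lbrakk>x \<in> carrier H; y \<in> carrier H; z \<in> carrier H\<rbrakk> \<Longrightarrow>
      hinner H (x \<oplus> y) z = hinner H x z + hinner H y z"
    and hinner_smult_left: "\<lbrakk>x \<in> carrier H; y \<in> carrier H\<rbrakk> \<Longrightarrow>
      hinner H (a \<odot> x) y = a * hinner H x y"
    and hinner_commute: "\<lbrakk>x \<in> carrier H; y \<in> carrier H\<rbrakk> \<Longrightarrow>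
      hinner H y x = cnj (hinner H x y)"
    and hinner_pos: "\<lbrakk>x \<in> carrier H; x \<noteq> \<zero>\<rbrakk> \<Longrightarrow> 0 < Re (hinner H x x)"

locale hilbert_space = complex_inner_space +
  assumes complete: "Metric_space.mcomplete (carrier H) (hdist H)"

context complex_inner_space
begin

lemma scalars_simps [simp]:
  "carrier complex_scalars = UNIV" "\<one>\<^bsub>complex_scalars\<^esub> = 1"
  "\<zero>\<^bsub>complex_scalars\<^esub> = 0" "a \<oplus>\<^bsub>complex_scalars\<^esub> b = a + b"
  "a \<otimes>\<^bsub>complex_scalars\<^esub> b = a * b"
  by (simp_all add: complex_scalars_def)

lemma scaled_closed [simp]: "x \<in> carrier H \<Longrightarrow> a \<odot> x \<in> carrier H"
  by simp

lemma hinner_zero_left [simp]: "y \<in> carrier H \<Longrightarrow> hinner H \<zero> y = 0"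
  using hinner_add_left[of \<zero> \<zero> y] by simp

lemma hinner_minus_left: "\<lbrakk>x \<in> carrier H; y \<in> carrier H\<rbrakk> \<Longrightarrow> hinner H (\<ominus> x) y = - hinner H x y"
  using hinner_add_left[of x "\<ominus> x" y] by (simp add: r_neg add_eq_0_iff)

lemma hinner_add_right: "\<lbrakk>x \<in> carrier H; y \<in> carrier H; z \<in> carrier H\<rbrakk> \<Longrightarrow>
    hinner H z (x \<oplus> y) = hinner H z x + hinner H z y"
  using hinner_add_left hinner_commute by (metis a_closed complex_cnj_add)

lemma hinner_smult_right: "\<lbrakk>x \<in> carrier H; y \<in> carrier H\<rbrakk> \<Longrightarrow>
    hinner H y (a \<odot> x) = cnj a * hinner H y x"
  using hinner_smult_left hinner_commute by (metis scaled_closed complex_cnj_mult)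

lemma hinner_self: "x \<in> carrier H \<Longrightarrow> hinner H x x = complex_of_real ((hnorm H x)\<^sup>2)"
proof -
  assume x: "x \<in> carrier H"
  have "0 \<le> Re (hinner H x x)"
    using hinner_pos[of x] x by (cases "x = \<zero>") auto
  moreover have "Im (hinner H x x) = 0"
    using hinner_commute[OF x x] by (metis complex_cnj_cancel_iff Reals_cnj_iff complex_is_Real_iff)
  ultimately show ?thesis by (simp add: hnorm_def complex_eq_iff)
qed

lemma hnorm_ge_0: "x \<in> carrier H \<Longrightarrow> 0 \<le> hnorm H x"
  using hinner_pos[of x] by (cases "x = \<zero>") (auto simp: hnorm_def)

lemma hnorm_eq_0_iff: "x \<in> carrier H \<Longrightarrow> hnorm H x = 0 \<longleftrightarrow> x = \<zero>"
  using hinner_pos[of x] by (cases "x = \<zero>") (auto simp: hnorm_def)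

lemma hinner_Cauchy_Schwarz:
  assumes x: "x \<in> carrier H" and y: "y \<in> carrier H"
  shows "cmod (hinner H x y) \<le> hnorm H x * hnorm H y"
proof (cases "y = \<zero>")
  case True
  then have "hinner H x y = 0"
    using x y hinner_commute[of \<zero> x] by simp
  then show ?thesis by (simp add: hnorm_ge_0 x y)
next
  case False
  define p where "p = hinner H x y"
  define r where "r = (hnorm H y)\<^sup>2"
  have r: "r > 0" using False y hnorm_eq_0_iff by (simp add: r_def)
  define a where "a = - p / complex_of_real r"
  define w where "w = x \<oplus> a \<odot> y"
  have ay: "a \<odot> y \<in> carrier H" using y by simp
  have w: "w \<in> carrier H" using x ay by (simp add: w_def)
  have "hinner H w w = hinner H x x + cnj a * p + a * (cnj p + cnj a * hinner H y y)"
    using x y ay hinner_commute[OF x y]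
    by (simp add: w_def p_def hinner_add_left hinner_add_right hinner_smult_left
        hinner_smult_right algebra_simps)
  also have "cnj p + cnj a * hinner H y y = 0"
    using r by (simp add: hinner_self[OF y] a_def r_def)
  finally have "complex_of_real ((hnorm H w)\<^sup>2) = complex_of_real ((hnorm H x)\<^sup>2) + cnj a * p"
    by (simp add: hinner_self w x)
  moreover have "cnj a * p = - complex_of_real ((cmod p)\<^sup>2 / r)"
    by (simp add: a_def complex_norm_square mult.commute flip: of_real_power)
  ultimately have "complex_of_real ((hnorm H w)\<^sup>2) =
      complex_of_real ((hnorm H x)\<^sup>2 - (cmod p)\<^sup>2 / r)" by simp
  then have "(hnorm H w)\<^sup>2 = (hnorm H x)\<^sup>2 - (cmod p)\<^sup>2 / r"
    using of_real_eq_iff by blast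
  then have "(cmod p)\<^sup>2 / r \<le> (hnorm H x)\<^sup>2"
    by (metis diff_ge_0_iff_ge zero_le_power2)
  then have "(cmod p)\<^sup>2 \<le> (hnorm H x * hnorm H y)\<^sup>2"
    using r by (simp add: divide_le_eq r_def power_mult_distrib)
  then show ?thesis
    unfolding p_def by (rule power2_le_imp_le) (simp add: hnorm_ge_0 x y)
qed

lemma hnorm_triangle:
  assumes x: "x \<in> carrier H" and y: "y \<in> carrier H"
  shows "hnorm H (x \<oplus> y) \<le> hnorm H x + hnorm H y"
proof (rule power2_le_imp_le)
  have sq: "Re (hinner H z z) = (hnorm H z)\<^sup>2" if "z \<in> carrier H" for z
    unfolding hinner_self[OF that] by (rule Re_complex_of_real)
  have "(hnorm H (x \<oplus> y))\<^sup>2 = Re (hinner H (x \<oplus> y) (x \<oplus> y))"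
    using x y by (simp add: sq)
  also have "\<dots> = (hnorm H x)\<^sup>2 + 2 * Re (hinner H x y) + (hnorm H y)\<^sup>2"
    using x y hinner_commute[OF x y] by (simp add: hinner_add_left hinner_add_right sq)
  also have "\<dots> \<le> (hnorm H x)\<^sup>2 + 2 * (hnorm H x * hnorm H y) + (hnorm H y)\<^sup>2"
    using hinner_Cauchy_Schwarz[OF x y] complex_Re_le_cmod[of "hinner H x y"] by simp
  finally show "(hnorm H (x \<oplus> y))\<^sup>2 \<le> (hnorm H x + hnorm H y)\<^sup>2"
    by (simp add: power2_sum)
qed (simp add: hnorm_ge_0 x y)

lemma hnorm_minus: "x \<in> carrier H \<Longrightarrow> hnorm H (\<ominus> x) = hnorm H x"
  using hinner_minus_left[of x "\<ominus> x"] hinner_minus_left[of x x] hinner_commute[of "\<ominus> x" x]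
  by (simp add: hnorm_def)

lemma Metric_space_hdist: "Metric_space (carrier H) (hdist H)"
proof
  fix x y z
  show "0 \<le> hdist H x y" by (simp add: hdist_def hnorm_ge_0)
  show "hdist H x y = hdist H y x"
    using hnorm_minus[of "x \<ominus> y"] by (auto simp: hdist_def a_minus_def minus_add a_comm)
  assume x: "x \<in> carrier H" and y: "y \<in> carrier H"
  show "hdist H x y = 0 \<longleftrightarrow> x = y"
  proof -
    have "x \<ominus> y = \<zero> \<longleftrightarrow> x = y"
      using x y by (metis a_minus_def a_inv_closed minus_equality minus_minus r_neg)
    then show ?thesis using x y by (simp add: hdist_def hnorm_eq_0_iff)
  qed
  assume z: "z \<in> carrier H"
  have "x \<ominus> z = (x \<ominus> y) \<oplus> (y \<ominus> z)"
    using x y z by (simp add: a_minus_def a_assoc r_neg1)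
  then show "hdist H x z \<le> hdist H x y + hdist H y z"
    using hnorm_triangle[of "x \<ominus> y" "y \<ominus> z"] x y z by (simp add: hdist_def)
qed

end

sublocale complex_inner_space \<subseteq> Metric_space "carrier H" "hdist H"
  by (rule Metric_space_hdist)


section \<open>Bounded operators and representations\<close>

text \<open>Norms and suprema are taken in \<^typ>\<open>ennreal\<close>: they may be infinite, and the supremum over
  the empty set is 0.\<close>

definition opnorm :: "'h hilbert \<Rightarrow> ('h \<Rightarrow> 'h) \<Rightarrow> ennreal" where
  "opnorm H A = (SUP x \<in> {x \<in> carrier H. hnorm H x \<le> 1}. ennreal (hnorm H (A x)))"

text \<open>Operators are extensional functions, so that equality of operators is equality
  on the carrier.\<close>

definition bounded_operators :: "'h hilbert \<Rightarrow> ('h \<Rightarrow> 'h) monoid" where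
  "bounded_operators H =
    \<lparr>carrier = {A \<in> carrier H \<rightarrow>\<^sub>E carrier H.
        (\<forall>x\<in>carrier H. \<forall>y\<in>carrier H. A (x \<oplus>\<^bsub>H\<^esub> y) = A x \<oplus>\<^bsub>H\<^esub> A y) \<and>
        (\<forall>a. \<forall>x\<in>carrier H. A (a \<odot>\<^bsub>H\<^esub> x) = a \<odot>\<^bsub>H\<^esub> A x) \<and>
        opnorm H A < \<infinity>},
     mult = (\<lambda>A B. compose (carrier H) A B),
     one = (\<lambda>x\<in>carrier H. x)\<rparr>"

definition strongly_continuous_rep ::
  "('g, 'm) monoid_scheme \<Rightarrow> 'g topology \<Rightarrow> 'h hilbert \<Rightarrow> ('g \<Rightarrow> 'h \<Rightarrow> 'h) \<Rightarrow> bool" where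
  "strongly_continuous_rep G T H \<pi> \<longleftrightarrow>
    \<pi> \<in> hom G (units_of (bounded_operators H)) \<and>
    (\<forall>x\<in>carrier H. continuous_map T (htopology H) (\<lambda>s. \<pi> s x))"

definition rep_norm ::
  "('g, 'm) monoid_scheme \<Rightarrow> 'h hilbert \<Rightarrow> ('g \<Rightarrow> 'h \<Rightarrow> 'h) \<Rightarrow> ennreal" where
  "rep_norm G H \<pi> = (SUP s\<in>carrier G. opnorm H (\<pi> s))"

text \<open>The members of $\mathcal{R}_c(G)$ acting on the Hilbert space \<open>H\<close>.\<close>

definition unif_bounded_reps ::
  "real \<Rightarrow> ('g, 'm) monoid_scheme \<Rightarrow> 'g topology \<Rightarrow> 'h hilbert \<Rightarrow> ('g \<Rightarrow> 'h \<Rightarrow> 'h) set" where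
  "unif_bounded_reps c G T H =
    {\<pi>. strongly_continuous_rep G T H \<pi> \<and> rep_norm G H \<pi> \<le> ennreal c}"

definition almost_has_invariant_vectors ::
  "'g topology \<Rightarrow> 'h hilbert \<Rightarrow> ('g \<Rightarrow> 'h \<Rightarrow> 'h) \<Rightarrow> bool" where
  "almost_has_invariant_vectors T H \<pi> \<longleftrightarrow>
    (\<forall>Q. compactin T Q \<longrightarrow> (\<forall>\<epsilon>>0. \<exists>\<xi>\<in>carrier H.
      (SUP s\<in>Q. ennreal (hnorm H (\<pi> s \<xi> \<ominus>\<^bsub>H\<^esub> \<xi>))) < ennreal (\<epsilon> * hnorm H \<xi>)))"

definition has_nonzero_invariant_vector ::
  "('g, 'm) monoid_scheme \<Rightarrow> 'h hilbert \<Rightarrow> ('g \<Rightarrow> 'h \<Rightarrow> 'h) \<Rightarrow> bool" where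
  "has_nonzero_invariant_vector G H \<pi> \<longleftrightarrow>
    (\<exists>\<xi>\<in>carrier H. \<xi> \<noteq> \<zero>\<^bsub>H\<^esub> \<and> (\<forall>s\<in>carrier G. \<pi> s \<xi> = \<xi>))"

definition affine_action ::
  "('g, 'm) monoid_scheme \<Rightarrow> 'g topology \<Rightarrow> 'h hilbert \<Rightarrow> ('g \<Rightarrow> 'h \<Rightarrow> 'h) \<Rightarrow>
    ('g \<Rightarrow> 'h \<Rightarrow> 'h) \<Rightarrow> bool" where
  "affine_action G T H \<pi> \<sigma> \<longleftrightarrow>
    strongly_continuous_rep G T H \<pi> \<and>
    (\<exists>b. continuous_map T (htopology H) b \<and>
      (\<forall>s\<in>carrier G. \<forall>t\<in>carrier G. b (s \<otimes>\<^bsub>G\<^esub> t) = \<pi> s (b t) \<oplus>\<^bsub>H\<^esub> b s) \<and>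
      (\<forall>s\<in>carrier G. \<forall>x\<in>carrier H. \<sigma> s x = \<pi> s x \<oplus>\<^bsub>H\<^esub> b s))"


section \<open>Properties (T) and (FH) relative to the bound c\<close>

text \<open>
  HOL cannot quantify over types within a formula, so both properties take as a parameter the type
  \<open>'h\<close> in which the carriers of the Hilbert spaces live, and quantify over all Hilbert spaces whose
  carrier is a set of elements of \<open>'h\<close>.
\<close>

definition property_T ::
  "'h itself \<Rightarrow> real \<Rightarrow> ('g, 'm) monoid_scheme \<Rightarrow> 'g topology \<Rightarrow> bool" where
  "property_T (_ :: 'h itself) c G T \<longleftrightarrow>
    (\<forall>H :: 'h hilbert. hilbert_space H \<longrightarrow>
      (\<forall>\<pi>\<in>unif_bounded_reps c G T H.
        almost_has_invariant_vectors T H \<pi> \<longrightarrow> has_nonzero_invariant_vector G H \<pi>))"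

definition property_FH ::
  "'h itself \<Rightarrow> real \<Rightarrow> ('g, 'm) monoid_scheme \<Rightarrow> 'g topology \<Rightarrow> bool" where
  "property_FH (_ :: 'h itself) c G T \<longleftrightarrow>
    (\<forall>H :: 'h hilbert. hilbert_space H \<longrightarrow>
      (\<forall>\<pi>\<in>unif_bounded_reps c G T H. \<forall>\<sigma>. affine_action G T H \<pi> \<sigma> \<longrightarrow>
        (\<exists>x\<in>carrier H. \<forall>s\<in>carrier G. \<sigma> s x = x)))"

end

theory Submission
  imports Defs
begin

text \<open>
  The proof is a hands-on version of Guichardet's open mapping argument and needs no Hilbert space
  other than that of the representation. Suppose \<open>\<pi>\<close> almost has invariant vectors but no nonzero
  invariant one, and put \<open>D s x = \<pi> s x - x\<close>. The coboundary map \<open>x \<mapsto> (s \<mapsto> D s x)\<close> is injective into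
  the cocycles with uniform convergence on compact sets, but it is not bounded below, so it cannot
  be onto: a suitable sequence of coboundaries converges to a cocycle that is not a coboundary. The
  affine action given by this cocycle has no fixed point.
\<close>

section \<open>Compact exhaustions and two closure facts in metric spaces\<close>

text \<open>Local compactness thickens each member of the compact cover to a compact neighbourhood,
  and finite unions make the sequence increasing. Every point has to be interior to some
  \<open>K n\<close>, so that uniform convergence on each \<open>K n\<close> becomes locally uniform
  and preserves continuity.\<close>

lemma compact_exhaustion:
  assumes "locally_compact_space T" and "Hausdorff_space T" and "sigma_compact_space T"
  obtains K :: "nat \<Rightarrow> 'g set" where "incseq K" and "\<And>n. compactin T (K n)"
    and "\<And>x. x \<in> topspace T \<Longrightarrow> \<exists>n U. openin T U \<and> x \<in> U \<and> U \<subseteq> K n"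
proof -
  obtain C where C: "\<And>n::nat. compactin T (C n)" "(\<Union>n. C n) = topspace T"
    using assms(3) unfolding sigma_compact_space_def by blast
  have "\<forall>n. \<exists>U L. openin T U \<and> compactin T L \<and> C n \<subseteq> U \<and> U \<subseteq> L"
    using C(1) assms(1,2) locally_compact_space_compact_closed_compact by metis
  then obtain U L where UL: "\<And>n. openin T (U n)" "\<And>n. compactin T (L n)"
    "\<And>n. C n \<subseteq> U n" "\<And>n. U n \<subseteq> L n"
    by metis
  show thesis
  proof
    show "incseq (\<lambda>n. \<Union>i\<le>n. L i)"
      by (rule incseq_SucI, rule UN_mono) auto
    show "compactin T (\<Union>i\<le>n. L i)" for n
      using UL(2) by (intro compactin_Union[OF finite_imageI]) auto
    show "\<exists>n V. openin T V \<and> x \<in> V \<and> V \<subseteq> (\<Union>i\<le>n. L i)" if x: "x \<in> topspace T" for x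
    proof -
      obtain n where "x \<in> C n" using x C(2) by blast
      then show ?thesis using UL(1,3,4)[of n] by (intro exI[of _ n] exI[of _ "U n"]) auto
    qed
  qed
qed

text \<open>Each single inequality passes to limits of sequences by its own Lipschitz bound. The
  constant \<open>B i\<close> may vary with \<open>i\<close>, so no common bound on a family of
  operators is required to apply this.\<close>

lemma (in Metric_space) closedin_Lipschitz_sublevels:
  assumes "\<And>i x y. \<lbrakk>i \<in> J; x \<in> M; y \<in> M\<rbrakk> \<Longrightarrow> f i x \<le> f i y + B i * d x y"
  shows "closedin mtopology {x \<in> M. \<forall>i\<in>J. f i x \<le> (c i :: real)}"
  unfolding metric_closedin_iff_sequentially_closed
proof (intro conjI allI impI)
  fix \<sigma> l
  assume "range \<sigma> \<subseteq> {x \<in> M. \<forall>i\<in>J. f i x \<le> c i} \<and> limitin mtopology \<sigma> l sequentially"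
  then have \<sigma>: "\<And>n. \<sigma> n \<in> M" "\<And>n i. i \<in> J \<Longrightarrow> f i (\<sigma> n) \<le> c i"
    and lim: "limitin mtopology \<sigma> l sequentially" by auto
  have l: "l \<in> M" using lim limitin_mspace by blast
  have d: "(\<lambda>n. d (\<sigma> n) l) \<longlonglongrightarrow> 0"
    using lim limitin_metric_dist_null by blast
  have "f i l \<le> c i" if i: "i \<in> J" for i
  proof (rule LIMSEQ_le_const)
    show "(\<lambda>n. c i + B i * d (\<sigma> n) l) \<longlonglongrightarrow> c i"
      using tendsto_add[OF tendsto_const tendsto_mult_left[OF d, of "B i"], of "c i"] by simp
    show "\<exists>N. \<forall>n\<ge>N. f i l \<le> c i + B i * d (\<sigma> n) l"
      using assms[OF i l] \<sigma> i by (metis add_right_mono commute order_trans)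
  qed
  then show "l \<in> {x \<in> M. \<forall>i\<in>J. f i x \<le> c i}" using l by blast
qed auto

text \<open>The usual \<epsilon>/3 argument. It uses the continuity of a single \<open>f k\<close>
  for each \<epsilon>, so one good index per \<epsilon> is all that \<open>lim\<close> has to
  provide.\<close>

lemma (in Metric_space) continuous_map_locally_uniform_limit:
  assumes f: "\<And>k::nat. continuous_map T mtopology (f k)"
    and g: "g \<in> topspace T \<rightarrow> M"
    and lim: "\<And>x. x \<in> topspace T \<Longrightarrow>
      \<exists>U. openin T U \<and> x \<in> U \<and> (\<forall>\<epsilon>>0. \<exists>k. \<forall>y\<in>U. d (f k y) (g y) < \<epsilon>)"
  shows "continuous_map T mtopology g"
  unfolding continuous_map_to_metric
proof (intro ballI allI impI)
  fix x and \<epsilon> :: real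
  assume x: "x \<in> topspace T" and "\<epsilon> > 0"
  then have e: "\<epsilon>/3 > 0" by simp
  obtain U k where U: "openin T U" "x \<in> U" and k: "\<And>y. y \<in> U \<Longrightarrow> d (f k y) (g y) < \<epsilon>/3"
    using lim[OF x] e by meson
  obtain V where V: "openin T V" "x \<in> V" "\<And>y. y \<in> V \<Longrightarrow> f k y \<in> mball (f k x) (\<epsilon>/3)"
    using f[of k] x e unfolding continuous_map_to_metric by meson
  have "g y \<in> mball (g x) \<epsilon>" if y: "y \<in> U \<inter> V" for y
  proof -
    have M: "f k x \<in> M" "f k y \<in> M" "g x \<in> M" "g y \<in> M"
      using V(3)[of y] y x g openin_subset[OF U(1)] by auto
    have "d (g x) (f k x) < \<epsilon>/3" "d (f k x) (f k y) < \<epsilon>/3" "d (f k y) (g y) < \<epsilon>/3"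
      using k[of x] k[of y] V(3)[of y] U y by (auto simp: commute)
    then have "d (g x) (g y) < \<epsilon>"
      using triangle[of "g x" "f k x" "g y"] triangle[of "f k x" "f k y" "g y"] M by linarith
    then show ?thesis using M by simp
  qed
  then show "\<exists>U. openin T U \<and> x \<in> U \<and> (\<forall>y\<in>U. g y \<in> mball (g x) \<epsilon>)"
    using U V by (intro exI[of _ "U \<inter> V"]) auto
qed

section \<open>Norm identities, limits and bounded linear maps in an inner product space\<close>

context complex_inner_space
begin

lemma hnorm_power2: "x \<in> carrier H \<Longrightarrow> (hnorm H x)\<^sup>2 = Re (hinner H x x)"
  by (simp add: hinner_self)

lemma hnorm_smult:
  assumes x: "x \<in> carrier H"
  shows "hnorm H (a \<odot> x) = cmod a * hnorm H x"
proof (rule power2_eq_imp_eq)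
  have "hinner H (a \<odot> x) (a \<odot> x) = (a * cnj a) * hinner H x x"
    using x by (simp add: hinner_smult_left hinner_smult_right)
  then have "complex_of_real ((hnorm H (a \<odot> x))\<^sup>2) = complex_of_real ((cmod a * hnorm H x)\<^sup>2)"
    using x by (simp only: hinner_self scaled_closed power_mult_distrib of_real_mult complex_norm_square)
  then show "(hnorm H (a \<odot> x))\<^sup>2 = (cmod a * hnorm H x)\<^sup>2"
    using of_real_eq_iff by blast
qed (simp_all add: hnorm_ge_0 x)

lemma parallelogram_law:
  assumes x: "x \<in> carrier H" and y: "y \<in> carrier H"
  shows "(hnorm H (x \<ominus> y))\<^sup>2 + (hnorm H (x \<oplus> y))\<^sup>2 = 2 * (hnorm H x)\<^sup>2 + 2 * (hnorm H y)\<^sup>2"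
proof -
  have "hinner H z (\<ominus> y) = - hinner H z y" if "z \<in> carrier H" for z
    using that y hinner_commute[of y z] hinner_commute[of "\<ominus> y" z] hinner_minus_left[of y z]
    by (metis a_inv_closed complex_cnj_minus complex_cnj_cancel_iff hinner_commute)
  then show ?thesis
    using x y by (simp add: hnorm_power2 a_minus_def hinner_add_left hinner_add_right hinner_minus_left)
qed

lemma hnorm_minus_le:
  assumes x: "x \<in> carrier H" and y: "y \<in> carrier H"
  shows "hnorm H x \<le> hnorm H y + hnorm H (x \<ominus> y)"
proof -
  have "x = y \<oplus> (x \<ominus> y)"
    using x y by (simp add: a_minus_def a_lcomm[of y x] r_neg)
  then show ?thesis using hnorm_triangle[of y "x \<ominus> y"] x y by simp
qed

lemma hnorm_minus_commute:
  assumes "x \<in> carrier H" and "y \<in> carrier H"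
  shows "hnorm H (x \<ominus> y) = hnorm H (y \<ominus> x)"
  using commute[of x y] assms by (simp add: hdist_def)


lemma closedin_hnorm_le: "closedin mtopology {x \<in> carrier H. hnorm H x \<le> r}"
proof -
  have "hnorm H x \<le> hnorm H y + 1 * hdist H x y" if "x \<in> carrier H" "y \<in> carrier H" for x y
    using hnorm_minus_le[OF that] that by (simp add: hdist_def)
  then show ?thesis
    using closedin_Lipschitz_sublevels[of "{()}" "\<lambda>_. hnorm H" "\<lambda>_. 1" "\<lambda>_. r"] by simp
qed

text \<open>Unlike membership in \<open>bounded_operators H\<close>, this leaves values off the
  carrier free, so that a difference such as \<open>\<lambda>x. A x \<ominus> x\<close> qualifies as
  it stands. A real bound takes the place of the \<open>ennreal\<close> operator norm.\<close>

definition bounded_linear_on :: "('h \<Rightarrow> 'h) \<Rightarrow> bool" where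
  "bounded_linear_on D \<longleftrightarrow> D \<in> carrier H \<rightarrow> carrier H \<and>
    (\<forall>x\<in>carrier H. \<forall>y\<in>carrier H. D (x \<oplus> y) = D x \<oplus> D y) \<and>
    (\<forall>a. \<forall>x\<in>carrier H. D (a \<odot> x) = a \<odot> D x) \<and>
    (\<exists>B. \<forall>x\<in>carrier H. hnorm H (D x) \<le> B * hnorm H x)"

lemma
  assumes "bounded_linear_on D" and x: "x \<in> carrier H"
  shows bounded_linear_on_closed [simp]: "D x \<in> carrier H"
    and bounded_linear_on_add: "y \<in> carrier H \<Longrightarrow> D (x \<oplus> y) = D x \<oplus> D y"
    and bounded_linear_on_smult: "D (a \<odot> x) = a \<odot> D x"
    and bounded_linear_on_minus: "y \<in> carrier H \<Longrightarrow> D (x \<ominus> y) = D x \<ominus> D y"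
proof -
  show 1: "D x \<in> carrier H" and "D (a \<odot> x) = a \<odot> D x"
    and 2: "y \<in> carrier H \<Longrightarrow> D (x \<oplus> y) = D x \<oplus> D y" for a y
    using assms unfolding bounded_linear_on_def by auto
  assume y: "y \<in> carrier H"
  have neg: "\<ominus> z = (-1) \<odot> z" if "z \<in> carrier H" for z
  proof -
    have "(1 + -1) \<odot> z = 1 \<odot> z \<oplus> (-1) \<odot> z"
      using smult_l_distr[of 1 "-1" z] that by simp
    moreover have "0 \<odot> z = \<zero>" "1 \<odot> z = z"
      using smult_l_null[of z] smult_one[of z] that by simp_all
    ultimately have "z \<oplus> (-1) \<odot> z = \<zero>" by simp
    then show ?thesis using that by (metis a_comm minus_equality scaled_closed)
  qed
  have Dy: "D y \<in> carrier H" "D ((-1) \<odot> y) = (-1) \<odot> D y"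
    and "D (x \<oplus> \<ominus> y) = D x \<oplus> D (\<ominus> y)"
    using assms y unfolding bounded_linear_on_def by auto
  moreover have "D (\<ominus> y) = \<ominus> D y"
    using Dy neg[of y] neg[of "D y"] y by simp
  ultimately  show "D (x \<ominus> y) = D x \<ominus> D y" by (simp add: a_minus_def)
qed

lemma bounded_linear_on_Lipschitz:
  assumes D: "bounded_linear_on D"
  shows "\<exists>B. \<forall>x\<in>carrier H. \<forall>y\<in>carrier H. hdist H (D x) (D y) \<le> B * hdist H x y"
proof -
  obtain B where B: "\<And>x. x \<in> carrier H \<Longrightarrow> hnorm H (D x) \<le> B * hnorm H x"
    using D unfolding bounded_linear_on_def by blast
  show ?thesis
  proof (intro exI ballI)
    fix x y assume "x \<in> carrier H" "y \<in> carrier H"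
    then show "hdist H (D x) (D y) \<le> B * hdist H x y"
      using B[of "x \<ominus> y"] D by (simp add: hdist_def bounded_linear_on_minus)
  qed
qed

lemma bounded_linear_on_limitin:
  assumes D: "bounded_linear_on D" and x: "range x \<subseteq> carrier H"
    and lim: "limitin mtopology x l sequentially"
  shows "limitin mtopology (\<lambda>n. D (x n)) (D l) sequentially"
proof -
  obtain B where B: "\<And>x y. \<lbrakk>x \<in> carrier H; y \<in> carrier H\<rbrakk> \<Longrightarrow> hdist H (D x) (D y) \<le> B * hdist H x y"
    using bounded_linear_on_Lipschitz[OF D] by blast
  have l: "l \<in> carrier H" and d: "(\<lambda>n. hdist H (x n) l) \<longlonglongrightarrow> 0"
    using lim limitin_metric_dist_null by blast+
  have "(\<lambda>n. hdist H (D (x n)) (D l)) \<longlonglongrightarrow> 0"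
  proof (rule tendsto_sandwich[OF _ _ tendsto_const])
    show "(\<lambda>n. B * hdist H (x n) l) \<longlonglongrightarrow> 0"
      using tendsto_mult_left[OF d, of B] by simp
      show "\<forall>\<^sub>F n in sequentially. hdist H (D (x n)) (D l) \<le> B * hdist H (x n) l"
      using x l B by (intro always_eventually) (auto simp: range_subsetD)
  qed simp
  then show ?thesis
    using D x l by (auto simp: limitin_metric_dist_null range_subsetD)
qed

lemma limitin_add:
  assumes x: "range x \<subseteq> carrier H" "limitin mtopology x l sequentially"
    and y: "range y \<subseteq> carrier H" "limitin mtopology y m sequentially"
  shows "limitin mtopology (\<lambda>n. x n \<oplus> y n) (l \<oplus> m) sequentially"
proof -
  have lm: "l \<in> carrier H" "m \<in> carrier H"
    using x y limitin_mspace by blast+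
  have xy: "x n \<in> carrier H" "y n \<in> carrier H" for n
    using x y by auto
  have d: "(\<lambda>n. hdist H (x n) l) \<longlonglongrightarrow> 0" "(\<lambda>n. hdist H (y n) m) \<longlonglongrightarrow> 0"
    using x y limitin_metric_dist_null by blast+
  have "(\<lambda>n. hdist H (x n \<oplus> y n) (l \<oplus> m)) \<longlonglongrightarrow> 0"
  proof (rule tendsto_sandwich[OF _ _ tendsto_const])
    show "(\<lambda>n. hdist H (x n) l + hdist H (y n) m) \<longlonglongrightarrow> 0"
      using tendsto_add[OF d] by simp
    have "(x n \<oplus> y n) \<ominus> (l \<oplus> m) = (x n \<ominus> l) \<oplus> (y n \<ominus> m)" for n
      using xy lm by (simp add: a_minus_def minus_add a_ac)
    then show "\<forall>\<^sub>F n in sequentially. hdist H (x n \<oplus> y n) (l \<oplus> m) \<le> hdist H (x n) l + hdist H (y n) m"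
      using hnorm_triangle[of "x _ \<ominus> l" "y _ \<ominus> m"] xy lm by (simp add: hdist_def)
  qed simp
  then show ?thesis
    using xy lm by (simp add: limitin_metric_dist_null)
qed

lemma continuous_map_minus_const:
  assumes f: "continuous_map T mtopology f" and x: "x \<in> carrier H"
  shows "continuous_map T mtopology (\<lambda>s. f s \<ominus> x)"
proof -
  have "(y \<ominus> x) \<ominus> (z \<ominus> x) = y \<ominus> z" if "y \<in> carrier H" "z \<in> carrier H" for y z
    using that x by (simp add: a_minus_def minus_add a_ac r_neg1 r_neg2)
  then have "z \<ominus> x \<in> mball (y \<ominus> x) e" if "z \<in> mball y e" for y z e
    using that x by (auto simp: in_mball hdist_def)
  then show ?thesis
    using f unfolding continuous_map_to_metric by meson
qed

lemma bounded_operator_imp_bounded_linear_on: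
  assumes A: "A \<in> carrier (bounded_operators H)"
  shows "bounded_linear_on A"
proof -
  have cl: "A \<in> carrier H \<rightarrow> carrier H"
    and add: "\<And>x y. \<lbrakk>x \<in> carrier H; y \<in> carrier H\<rbrakk> \<Longrightarrow> A (x \<oplus> y) = A x \<oplus> A y"
    and smult: "\<And>a x. x \<in> carrier H \<Longrightarrow> A (a \<odot> x) = a \<odot> A x"
    and fin: "opnorm H A < \<infinity>"
    using A by (auto simp: bounded_operators_def)
  define B where "B = enn2real (opnorm H A)"
  have unit: "hnorm H (A x) \<le> B" if "x \<in> carrier H" "hnorm H x \<le> 1" for x
  proof -
    have "ennreal (hnorm H (A x)) \<le> opnorm H A"
      unfolding opnorm_def using that by (intro SUP_upper) simp
    \<comment> \<open>Finiteness of the operator norm is essential here, since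
      \<open>enn2real\<close> sends infinity to 0.\<close>
    then show ?thesis
      using fin enn2real_mono[of "ennreal (hnorm H (A x))" "opnorm H A"] that cl
      by (simp add: B_def hnorm_ge_0 Pi_iff less_top)
  qed
  have "hnorm H (A x) \<le> B * hnorm H x" if x: "x \<in> carrier H" for x
  proof (cases "x = \<zero>")
    case True
    have "A (0 \<odot> \<zero>) = 0 \<odot> A \<zero>" by (rule smult) simp
    then have "A \<zero> = \<zero>"
      using smult_l_null[of "\<zero>"] smult_l_null[of "A \<zero>"] cl by (simp add: Pi_iff)
    then show ?thesis using True hnorm_eq_0_iff[of \<zero>] by simp
  next
    case False
    then have pos: "hnorm H x > 0"
      using hnorm_ge_0[OF x] hnorm_eq_0_iff[OF x] by simp
    have Ax: "A x \<in> carrier H" using cl x by auto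
    have "hnorm H (A (complex_of_real (1 / hnorm H x) \<odot> x)) \<le> B"
      using pos x by (intro unit) (auto simp: hnorm_smult norm_divide)
    then show ?thesis
      using pos x by (simp add: smult hnorm_smult[OF Ax] norm_divide field_simps)
  qed
  then show ?thesis
    unfolding bounded_linear_on_def using cl add smult by blast
qed

lemma bounded_linear_on_minus_id:
  assumes A: "bounded_linear_on A"
  shows "bounded_linear_on (\<lambda>x. A x \<ominus> x)"
proof -
  obtain B where B: "\<And>x. x \<in> carrier H \<Longrightarrow> hnorm H (A x) \<le> B * hnorm H x"
    using A unfolding bounded_linear_on_def by blast
  show ?thesis
    unfolding bounded_linear_on_def
  proof (intro conjI ballI allI)
    show "A (x \<oplus> y) \<ominus> (x \<oplus> y) = (A x \<ominus> x) \<oplus> (A y \<ominus> y)"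
      if "x \<in> carrier H" "y \<in> carrier H" for x y
      using that A by (simp add: bounded_linear_on_add a_minus_def minus_add a_ac)
    show "A (a \<odot> x) \<ominus> a \<odot> x = a \<odot> (A x \<ominus> x)" if "x \<in> carrier H" for a x
      using that A smult_r_minus[of a x]
      by (simp add: bounded_linear_on_smult a_minus_def smult_r_distr)
    show "\<exists>B. \<forall>x\<in>carrier H. hnorm H (A x \<ominus> x) \<le> B * hnorm H x"
    proof (intro exI ballI)
      fix x assume x: "x \<in> carrier H"
      have "hnorm H (A x \<ominus> x) \<le> hnorm H (A x) + hnorm H x"
        using hnorm_triangle[of "A x" "\<ominus> x"] x A by (simp add: a_minus_def hnorm_minus)
      then show "hnorm H (A x \<ominus> x) \<le> (B + 1) * hnorm H x"
        using B[OF x] by (simp add: distrib_right)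
    qed
  qed (use A in auto)
qed

end

section \<open>The open mapping argument in a Hilbert space\<close>

context hilbert_space
begin

text \<open>By the parallelogram law, near-minimisers of the norm in the members of the sequence form a
  Cauchy sequence. This replaces weak compactness of balls.\<close>

lemma nested_closed_convex_Inter_nonempty:
  assumes closed: "\<And>n::nat. closedin mtopology (C n)"
    and nonempty: "\<And>n. C n \<noteq> {}"
    and decseq: "decseq C"
    and midpoint: "\<And>n x y. \<lbrakk>x \<in> C n; y \<in> C n\<rbrakk> \<Longrightarrow> complex_of_real (1/2) \<odot> (x \<oplus> y) \<in> C n"
    and bounded: "\<And>x. x \<in> C 0 \<Longrightarrow> hnorm H x \<le> r"
  shows "\<exists>x. \<forall>n. x \<in> C n"
proof -
  have sub: "C n \<subseteq> carrier H" for n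
    using closedin_subset[OF closed] by simp
  have le: "C m \<subseteq> C n" if "n \<le> m" for m n
    using decseq that by (simp add: decseqD)
  \<comment> \<open>The distance from the origin to \<open>C n\<close>. It increases because the
    sets shrink, and it is bounded by \<open>r\<close>, so it converges.\<close>
  define d where "d n = Inf (hnorm H ` C n)" for n
  have bdd: "bdd_below (hnorm H ` C n)" for n
    using sub hnorm_ge_0 by (intro bdd_belowI[of _ 0]) auto
  have d_le: "d n \<le> hnorm H x" if "x \<in> C n" for n x
    using that bdd by (simp add: d_def cINF_lower)
  have d_ge0: "0 \<le> d n" for n
    unfolding d_def using nonempty sub hnorm_ge_0 by (intro cINF_greatest) auto
  have "incseq d"
    unfolding incseq_def d_def using cINF_superset_mono[OF nonempty bdd le] by simp
  moreover have "d n \<le> r" for n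
  proof -
    obtain x where "x \<in> C n" using nonempty by blast
    then show ?thesis using d_le[of x n] bounded[of x] le[of 0 n] by auto
  qed
  ultimately obtain l where l: "d \<longlonglongrightarrow> l" and dl: "\<And>n. d n \<le> l"
    by (meson incseq_convergent)
  have "\<exists>x\<in>C n. hnorm H x < d n + inverse (real (Suc n))" for n
    using cINF_less_iff[OF nonempty bdd, of n "d n + inverse (real (Suc n))"] by (simp add: d_def)
  then obtain x where x: "\<And>n. x n \<in> C n" and xd: "\<And>n. hnorm H (x n) < d n + inverse (real (Suc n))"
    by metis
  have xH: "x n \<in> carrier H" for n using x sub by blast
  \<comment> \<open>This is what the parallelogram law leaves for \<open>x n\<close> and a later
    \<open>x m\<close>: the first two terms bound their norms, with \<open>l\<close> dominating
    every \<open>d m\<close>, and the last comes from their midpoint. In the limit the terms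
    cancel.\<close>
  define g where "g n = 2 * (d n + inverse (real (Suc n)))\<^sup>2 + 2 * (l + inverse (real (Suc n)))\<^sup>2
    - 4 * (d n)\<^sup>2" for n
  have "g \<longlonglongrightarrow> 2 * (l + 0)\<^sup>2 + 2 * (l + 0)\<^sup>2 - 4 * l\<^sup>2"
    unfolding g_def by (intro tendsto_intros l LIMSEQ_inverse_real_of_nat)
  then have g0: "g \<longlonglongrightarrow> 0" by simp
  have dist_le: "(hdist H (x n) (x m))\<^sup>2 \<le> g n" if nm: "n \<le> m" for n m
  proof -
    let ?z = "complex_of_real (1/2) \<odot> (x n \<oplus> x m)"
    \<comment> \<open>The midpoint stays in the larger set \<open>C n\<close>, so its norm is at
      least \<open>d n\<close>.\<close>
    have "?z \<in> C n" using midpoint x le[OF nm] by blast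
    then have "d n \<le> hnorm H (x n \<oplus> x m) / 2"
      using d_le[of ?z n] xH by (simp add: hnorm_smult)
    then have "4 * (d n)\<^sup>2 \<le> (hnorm H (x n \<oplus> x m))\<^sup>2"
      using power_mono[of "2 * d n" "hnorm H (x n \<oplus> x m)" 2] d_ge0[of n] by (simp add: power_mult_distrib)
    moreover have "(hnorm H (x n))\<^sup>2 \<le> (d n + inverse (real (Suc n)))\<^sup>2"
      using xd[of n] xH by (intro power_mono) (auto simp: hnorm_ge_0)
    moreover have "hnorm H (x m) \<le> l + inverse (real (Suc n))"
    proof -
      have "inverse (real (Suc m)) \<le> inverse (real (Suc n))" using nm by simp
      then show ?thesis using xd[of m] dl[of m] by linarith
    qed
    then have "(hnorm H (x m))\<^sup>2 \<le> (l + inverse (real (Suc n)))\<^sup>2"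
      using xH by (intro power_mono) (auto simp: hnorm_ge_0)
    ultimately show ?thesis
      using parallelogram_law[OF xH xH, of n m] xH by (simp add: g_def hdist_def)
  qed
  have "MCauchy x"
    unfolding MCauchy_def
  proof (intro conjI allI impI)
    show "range x \<subseteq> carrier H" using xH by blast
    fix e :: real assume e: "e > 0"
    then have "\<forall>\<^sub>F n in sequentially. g n < (e/2)\<^sup>2"
      by (intro order_tendstoD(2)[OF g0]) simp
    then obtain N where N: "g N < (e/2)\<^sup>2"
      by (auto simp: eventually_sequentially)
    \<comment> \<open>All later terms are compared with the fixed term \<open>x N\<close>, because
      \<open>dist_le\<close> controls the distance through the smaller index.\<close>
    have "hdist H (x N) (x n) < e/2" if "n \<ge> N" for n
      using dist_le[OF that] N e by (intro power2_less_imp_less[of _ "e/2"]) auto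
    then show "\<exists>N. \<forall>n n'. N \<le> n \<longrightarrow> N \<le> n' \<longrightarrow> hdist H (x n) (x n') < e"
      using xH triangle[of "x _" "x N" "x _"] commute[of "x _" "x N"]
      by (smt (verit, ccfv_threshold) field_sum_of_halves)
  qed
  then obtain y where y: "limitin mtopology x y sequentially"
    using complete unfolding mcomplete_def by blast
  have "y \<in> C n" for n
  proof (rule limitin_closedin[OF y closed])
    show "\<forall>\<^sub>F k in sequentially. x k \<in> C n"
      using eventually_ge_at_top[of n] by eventually_elim (use x le in blast)
  qed simp
  then show ?thesis by blast
qed

text \<open>Otherwise, for every \<open>n\<close>, some point of the ball of radius \<open>r\<close>
  has nearly the same image as \<open>S\<close> on \<open>K n\<close>. Such points, with tolerance
  1/(n+1), form nonempty closed convex sets decreasing in \<open>n\<close>. A common point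
  \<open>x\<close> satisfies \<open>D s (S \<ominus> x) = \<zero>\<close> throughout, so
  \<open>x = S\<close> by injectivity, although \<open>S\<close> lies outside the ball.\<close>

lemma bounded_preimage_gap:
  assumes D: "\<And>s n. s \<in> K n \<Longrightarrow> bounded_linear_on (D s)"
    and K: "incseq K"
    and inj: "\<And>x. \<lbrakk>x \<in> carrier H; \<And>n s. s \<in> K n \<Longrightarrow> D s x = \<zero>\<rbrakk> \<Longrightarrow> x = \<zero>"
    and S: "S \<in> carrier H" and r: "r < hnorm H S"
  shows "\<exists>n \<eta>. 0 < \<eta> \<and> (\<forall>x\<in>carrier H. hnorm H x \<le> r \<longrightarrow> (\<exists>s\<in>K n. \<eta> \<le> hnorm H (D s (S \<ominus> x))))"
proof (rule ccontr)
  assume "\<not> ?thesis"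
  then have far: "\<exists>x\<in>carrier H. hnorm H x \<le> r \<and> (\<forall>s\<in>K n. hnorm H (D s (S \<ominus> x)) \<le> \<eta>)"
    if "0 < \<eta>" for n \<eta>
    using that by (meson linorder_not_le less_imp_le)
  define A where "A n = {x \<in> carrier H. \<forall>s\<in>K n. hnorm H (D s (S \<ominus> x)) \<le> inverse (real (Suc n))}"
    for n
  define C where "C n = {x \<in> carrier H. hnorm H x \<le> r} \<inter> A n" for n
  have "\<exists>x. \<forall>n. x \<in> C n"
  proof (rule nested_closed_convex_Inter_nonempty)
    fix n
    obtain B where B: "\<And>s x y. \<lbrakk>s \<in> K n; x \<in> carrier H; y \<in> carrier H\<rbrakk> \<Longrightarrow>
        hdist H (D s x) (D s y) \<le> B s * hdist H x y"
      using bounded_linear_on_Lipschitz[OF D] by metis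
    have "closedin mtopology (A n)"
      unfolding A_def
    proof (rule closedin_Lipschitz_sublevels)
      fix s x y assume *: "s \<in> K n" "x \<in> carrier H" "y \<in> carrier H"
      have eq: "(S \<ominus> x) \<ominus> (S \<ominus> y) = y \<ominus> x"
        using S * by (simp add: a_minus_def minus_add a_ac r_neg1 r_neg2)
      have "hnorm H (D s (S \<ominus> x)) \<le> hnorm H (D s (S \<ominus> y)) + hdist H (D s (S \<ominus> x)) (D s (S \<ominus> y))"
        using hnorm_minus_le[of "D s (S \<ominus> x)" "D s (S \<ominus> y)"] D[OF *(1)] S * by (simp add: hdist_def)
      also have "hdist H (D s (S \<ominus> x)) (D s (S \<ominus> y)) \<le> B s * hdist H (S \<ominus> x) (S \<ominus> y)"
        using B[OF *(1)] S * by simp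
      also have "hdist H (S \<ominus> x) (S \<ominus> y) = hdist H x y"
        using S * hnorm_minus_commute[of x y] by (simp add: hdist_def eq)
      finally show "hnorm H (D s (S \<ominus> x)) \<le> hnorm H (D s (S \<ominus> y)) + B s * hdist H x y" by simp
    qed
    then show "closedin mtopology (C n)"
      unfolding C_def using closedin_hnorm_le by blast
    show "C n \<noteq> {}"
      using far[of "inverse (real (Suc n))" n] unfolding C_def A_def by auto
    show "complex_of_real (1/2) \<odot> (x \<oplus> y) \<in> C n" if "x \<in> C n" "y \<in> C n" for x y
    proof -
      let ?h = "complex_of_real (1/2)" and ?e = "inverse (real (Suc n))"
      have xy: "x \<in> carrier H" "y \<in> carrier H" "hnorm H x \<le> r" "hnorm H y \<le> r"
        and xA: "\<And>s. s \<in> K n \<Longrightarrow> hnorm H (D s (S \<ominus> x)) \<le> ?e"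
        and yA: "\<And>s. s \<in> K n \<Longrightarrow> hnorm H (D s (S \<ominus> y)) \<le> ?e"
        using that by (auto simp: C_def A_def)
      \<comment> \<open>Midpoint convexity of balls around the origin. It serves both the ball of
        radius \<open>r\<close> and the bound on the values of \<open>D s\<close>.\<close>
      have mid: "hnorm H (?h \<odot> (u \<oplus> v)) \<le> e" if "u \<in> carrier H" "v \<in> carrier H" "hnorm H u \<le> e"
        "hnorm H v \<le> e" for u v e
        using hnorm_triangle[of u v] that by (simp add: hnorm_smult)
      have half: "?h \<odot> (S \<oplus> S) = S"
      proof -
        have "?h \<odot> (S \<oplus> S) = (?h + ?h) \<odot> S"
          using smult_l_distr[of ?h ?h S] S by (simp add: smult_r_distr)
        then show ?thesis using S smult_one[of S] by simp
      qed
      have neg: "?h \<odot> (\<ominus> z) = \<ominus> (?h \<odot> z)" if "z \<in> carrier H" for z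
        using smult_r_minus[of ?h z] that by simp
      \<comment> \<open>Writing the difference as an average of \<open>S \<ominus> x\<close> and
        \<open>S \<ominus> y\<close> lets the linear map \<open>D s\<close> pass through it.\<close>
      have eq: "S \<ominus> ?h \<odot> (x \<oplus> y) = ?h \<odot> ((S \<ominus> x) \<oplus> (S \<ominus> y))"
      proof -
        have "(S \<ominus> x) \<oplus> (S \<ominus> y) = (S \<oplus> S) \<oplus> \<ominus> (x \<oplus> y)"
          using S xy by (simp add: a_minus_def minus_add a_ac)
        then have "?h \<odot> ((S \<ominus> x) \<oplus> (S \<ominus> y)) = ?h \<odot> (S \<oplus> S) \<oplus> ?h \<odot> (\<ominus> (x \<oplus> y))"
          using S xy by (simp add: smult_r_distr)
        then show ?thesis using S xy neg[of "x \<oplus> y"] unfolding half by (simp add: a_minus_def)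
      qed
      have "hnorm H (D s (S \<ominus> ?h \<odot> (x \<oplus> y))) \<le> ?e" if s: "s \<in> K n" for s
      proof -
        have "D s (S \<ominus> ?h \<odot> (x \<oplus> y)) = ?h \<odot> (D s (S \<ominus> x) \<oplus> D s (S \<ominus> y))"
          using D[OF s] S xy unfolding eq by (simp add: bounded_linear_on_smult bounded_linear_on_add)
        then show ?thesis
          using mid[OF _ _ xA[OF s] yA[OF s]] D[OF s] S xy by simp
      qed
      then show ?thesis using xy mid[of x y r] by (simp add: C_def A_def)
    qed
  next
    show "decseq C"
    proof (rule decseq_SucI)
      fix n
      have e: "inverse (real (Suc (Suc n))) \<le> inverse (real (Suc n))" by simp
      show "C (Suc n) \<subseteq> C n"
        using incseq_SucD[OF K, of n] order_trans[OF _ e] unfolding C_def A_def by blast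
    qed
      show "hnorm H x \<le> r" if "x \<in> C 0" for x using that by (simp add: C_def)
  qed
  then obtain x where x: "x \<in> carrier H" "hnorm H x \<le> r" and xA: "\<And>n. x \<in> A n"
    by (auto simp: C_def)
  have "S \<ominus> x = \<zero>"
  proof (rule inj)
    fix n s assume s: "s \<in> K n"
    \<comment> \<open>As \<open>K\<close> increases, \<open>s\<close> lies in every later
      \<open>K m\<close>, so the tolerances of all later stages apply to it.\<close>
    have "hnorm H (D s (S \<ominus> x)) \<le> inverse (real (Suc m))" if "m \<ge> n" for m
      using xA[of m] s incseqD[OF K that] by (auto simp: A_def)
    then have "hnorm H (D s (S \<ominus> x)) \<le> 0"
      by (intro LIMSEQ_le_const[OF LIMSEQ_inverse_real_of_nat]) blast
    then show "D s (S \<ominus> x) = \<zero>"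
      using hnorm_ge_0[of "D s (S \<ominus> x)"] hnorm_eq_0_iff[of "D s (S \<ominus> x)"] D[OF s] S x by simp
  qed (use S x in simp)
  then have "hnorm H S \<le> hnorm H x"
    using hnorm_minus_le[of S x] hnorm_eq_0_iff[of \<zero>] S x by simp
  then show False using r x by simp
qed

text \<open>A gliding hump: \<open>S n\<close> has norm above \<open>n\<close>, so the preceding lemma bounds the distance on
  \<open>K (m n)\<close> between \<open>s \<mapsto> D s (S n)\<close> and \<open>s \<mapsto> D s x\<close> from below by some \<open>\<eta> n\<close>, for all \<open>x\<close> of norm
  at most \<open>n\<close>. Later increments of \<open>S\<close> are chosen too small to close this gap.\<close>

lemma limit_outside_range:
  assumes D: "\<And>s n. s \<in> K n \<Longrightarrow> bounded_linear_on (D s)"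
    and K: "incseq K"
    and inj: "\<And>x. \<lbrakk>x \<in> carrier H; \<And>n s. s \<in> K n \<Longrightarrow> D s x = \<zero>\<rbrakk> \<Longrightarrow> x = \<zero>"
    and small: "\<And>n \<epsilon>. 0 < \<epsilon> \<Longrightarrow>
      \<exists>\<xi>\<in>carrier H. 0 < hnorm H \<xi> \<and> (\<forall>s\<in>K n. hnorm H (D s \<xi>) \<le> \<epsilon> * hnorm H \<xi>)"
  obtains S b where "range S \<subseteq> carrier H"
    and "\<And>n s. s \<in> K n \<Longrightarrow> limitin mtopology (\<lambda>k. D s (S k)) (b s) sequentially"
    and "\<And>n \<epsilon>. 0 < \<epsilon> \<Longrightarrow> \<exists>k. \<forall>s\<in>K n. hdist H (D s (S k)) (b s) < \<epsilon>"
    and "\<And>x. x \<in> carrier H \<Longrightarrow> \<exists>n. \<exists>s\<in>K n. b s \<noteq> D s x"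
proof -
  \<comment> \<open>Almost invariance is homogeneous: asking for relative error \<epsilon>/R and
    rescaling to norm \<open>R\<close> gives absolute error \<epsilon>. So arbitrarily long vectors
    can have arbitrarily small image on \<open>K n\<close>.\<close>
  have scaled: "\<exists>\<xi>\<in>carrier H. hnorm H \<xi> = R \<and> (\<forall>s\<in>K n. hnorm H (D s \<xi>) \<le> \<epsilon>)"
    if R: "0 < R" and e: "0 < \<epsilon>" for n R \<epsilon>
  proof -
    obtain \<xi> where \<xi>: "\<xi> \<in> carrier H" "0 < hnorm H \<xi>"
      and D\<xi>: "\<And>s. s \<in> K n \<Longrightarrow> hnorm H (D s \<xi>) \<le> \<epsilon> / R * hnorm H \<xi>"
      using small[of "\<epsilon> / R" n] R e by auto
    let ?a = "complex_of_real (R / hnorm H \<xi>)"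
    have a: "cmod ?a = R / hnorm H \<xi>"
      using R \<xi> by (simp only: norm_of_real) simp
    have "hnorm H (D s (?a \<odot> \<xi>)) \<le> \<epsilon>" if s: "s \<in> K n" for s
    proof -
      have "hnorm H (D s (?a \<odot> \<xi>)) = R / hnorm H \<xi> * hnorm H (D s \<xi>)"
        using bounded_linear_on_smult[OF D[OF s] \<xi>(1), of ?a] hnorm_smult[of "D s \<xi>" ?a] D[OF s] \<xi>
        by (simp only: a bounded_linear_on_closed)
      also have "\<dots> \<le> R / hnorm H \<xi> * (\<epsilon> / R * hnorm H \<xi>)"
        using D\<xi>[OF s] R \<xi> by (intro mult_left_mono) auto
      also have "\<dots> = \<epsilon>" using R \<xi> by simp
      finally show ?thesis .
    qed
    moreover have "hnorm H (?a \<odot> \<xi>) = R"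
      using \<xi> hnorm_smult[OF \<xi>(1), of ?a] unfolding a by simp
    ultimately show ?thesis using \<xi>(1) by (intro bexI[of _ "?a \<odot> \<xi>"]) auto
  qed
  \<comment> \<open>The last clause is the separation at stage \<open>n\<close>. The condition
    \<open>n \<le> m\<close> makes the sets \<open>K m\<close> exhaust all \<open>K n\<close>, and
    the geometric bound on \<eta> makes the images of the sequence converge uniformly on each of
    them.\<close>
  define gap where "gap n S m \<eta> \<longleftrightarrow> S \<in> carrier H \<and> real n < hnorm H S \<and> n \<le> m \<and> 0 < \<eta> \<and> \<eta> \<le> (1/2)^n \<and>
      (\<forall>x\<in>carrier H. hnorm H x \<le> real n \<longrightarrow> (\<exists>s\<in>K m. \<eta> \<le> hnorm H (D s (S \<ominus> x))))"
    for n S m \<eta>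
  have gap_ex: "\<exists>m \<eta>. gap n S m \<eta> \<and> m0 \<le> m \<and> \<eta> \<le> \<eta>0"
    if S: "S \<in> carrier H" "real n < hnorm H S" and \<eta>0: "0 < \<eta>0" for n S m0 \<eta>0
  proof -
    obtain m \<eta> where \<eta>: "0 < \<eta>"
      and far: "\<And>x. \<lbrakk>x \<in> carrier H; hnorm H x \<le> real n\<rbrakk> \<Longrightarrow> \<exists>s\<in>K m. \<eta> \<le> hnorm H (D s (S \<ominus> x))"
    proof -
      have "\<exists>m \<eta>. 0 < \<eta> \<and>
          (\<forall>x\<in>carrier H. hnorm H x \<le> real n \<longrightarrow> (\<exists>s\<in>K m. \<eta> \<le> hnorm H (D s (S \<ominus> x))))"
        by (rule bounded_preimage_gap) (fact D K inj S)+
      then show thesis using that by blast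
    qed
    \<comment> \<open>Enlarging \<open>K m\<close> and lowering \<eta> only weaken the separation,
      so the remaining constraints can be met by a maximum and a minimum.\<close>
    let ?m = "max m (max n m0)" and ?\<eta> = "min \<eta> (min \<eta>0 ((1/2)^n))"
    have "K m \<subseteq> K ?m" using incseqD[OF K] by simp
    then have "\<exists>s\<in>K ?m. ?\<eta> \<le> hnorm H (D s (S \<ominus> x))" if "x \<in> carrier H" "hnorm H x \<le> real n" for x
      using far[OF that] by (meson min.coboundedI1 subsetD)
    then have "gap n S ?m ?\<eta>" using S \<eta> \<eta>0 by (simp add: gap_def le_max_iff_disj min_le_iff_disj)
    then show ?thesis by (intro exI[of _ ?m] exI[of _ ?\<eta>]) auto
  qed
  define P where "P n = (\<lambda>(S, m, \<eta>). gap n S m \<eta>)" for n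
  \<comment> \<open>With \<eta> halving at each stage and increments of at most \<eta>/4, all
    increments after a stage add up to at most \<eta>/2, strictly less than the gap \<eta> of that
    stage.\<close>
  define Q where "Q = (\<lambda>(S, m, \<eta>) (S', m', \<eta>'). m \<le> m' \<and> \<eta>' \<le> \<eta> / 2 \<and>
      (\<forall>s\<in>K m. hnorm H (D s (S' \<ominus> S)) \<le> \<eta> / 4))"
  have "\<exists>f. \<forall>n. P n (f n) \<and> Q (f n) (f (Suc n))"
  proof (rule dependent_nat_choice)
    obtain \<xi> where "\<xi> \<in> carrier H" "0 < hnorm H \<xi>" using small[of 1] by auto
    then show "\<exists>z. P 0 z" using gap_ex[of \<xi> 0 1 0] unfolding P_def by auto
  next
    fix z n assume "P n z"
    then obtain S m \<eta> where z: "z = (S, m, \<eta>)" and g: "gap n S m \<eta>"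
      unfolding P_def by (cases z) auto
    then have S: "S \<in> carrier H" and \<eta>: "0 < \<eta>" by (auto simp: gap_def)
    \<comment> \<open>By the triangle inequality this norm puts \<open>S \<oplus> \<xi>\<close> at
      norm at least n+2, above the n+1 demanded at the next stage.\<close>
    obtain \<xi> where \<xi>: "\<xi> \<in> carrier H" "hnorm H \<xi> = hnorm H S + n + 2"
      and D\<xi>: "\<And>s. s \<in> K m \<Longrightarrow> hnorm H (D s \<xi>) \<le> \<eta> / 4"
      using scaled[of "hnorm H S + n + 2" "\<eta> / 4" m] \<eta> hnorm_ge_0[OF S] by auto
    have diff: "(S \<oplus> \<xi>) \<ominus> S = \<xi>" "\<xi> \<ominus> (S \<oplus> \<xi>) = \<ominus> S"
      using S \<xi>
      by (simp_all add: a_minus_def minus_add a_assoc a_lcomm[of S \<xi>] a_lcomm[of \<xi> "\<ominus> S"] r_neg)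
    have "real (Suc n) < hnorm H (S \<oplus> \<xi>)"
      using hnorm_minus_le[of \<xi> "S \<oplus> \<xi>"] S \<xi> by (simp add: diff hnorm_minus)
    then obtain m' \<eta>' where "gap (Suc n) (S \<oplus> \<xi>) m' \<eta>'" "m \<le> m'" "\<eta>' \<le> \<eta> / 2"
      using gap_ex[of "S \<oplus> \<xi>" "Suc n" "\<eta> / 2" m] S \<xi> \<eta> by auto
    then show "\<exists>z'. P (Suc n) z' \<and> Q z z'"
      unfolding z P_def Q_def using D\<xi> by (intro exI[of _ "(S \<oplus> \<xi>, m', \<eta>')"]) (simp add: diff)
  qed
  then obtain f where f: "\<And>n. P n (f n)" "\<And>n. Q (f n) (f (Suc n))" by blast
  define S where "S n = fst (f n)" for n
  define m where "m n = fst (snd (f n))" for n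
  define \<eta> where "\<eta> n = snd (snd (f n))" for n
  have gap: "gap n (S n) (m n) (\<eta> n)" for n
    using f(1)[of n] by (simp add: P_def S_def m_def \<eta>_def case_prod_beta)
  have step: "m n \<le> m (Suc n)" "\<eta> (Suc n) \<le> \<eta> n / 2"
    "\<And>s. s \<in> K (m n) \<Longrightarrow> hnorm H (D s (S (Suc n) \<ominus> S n)) \<le> \<eta> n / 4" for n
    using f(2)[of n] by (auto simp: Q_def S_def m_def \<eta>_def case_prod_beta)
  have S: "S n \<in> carrier H" and nm: "n \<le> m n" and \<eta>: "0 < \<eta> n" "\<eta> n \<le> (1/2)^n" for n
    using gap[of n] by (auto simp: gap_def)
  have Km: "K (m n) \<subseteq> K (m k)" if "n \<le> k" for n k
    using lift_Suc_mono_le[of m n k] step(1) that incseqD[OF K] by simp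
  have Kn: "K n \<subseteq> K (m n)" for n using incseqD[OF K nm] .
  have DS: "D s (S k) \<in> carrier H" if "s \<in> K n" for s n k
    using D[OF that] S by simp
  \<comment> \<open>Subtracting \<open>\<eta> k / 2\<close> makes the induction close: halving gives
    \<open>\<eta> k / 4 \<le> \<eta> k / 2 - \<eta> (Suc k) / 2\<close>, which absorbs the new
    increment.\<close>
  have tele: "hdist H (D s (S k)) (D s (S n)) \<le> \<eta> n / 2 - \<eta> k / 2" if "n \<le> k" "s \<in> K (m n)" for s n k
    using that
  proof (induction k rule: dec_induct)
    case base
    then show ?case using DS[of s "m n" n] by (simp add: mdist_zero)
  next
    case (step k)
    have s: "s \<in> K (m k)" using Km[OF step(1)] step.prems by blast
    have "hdist H (D s (S (Suc k))) (D s (S k)) \<le> \<eta> k / 4"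
      using \<open>\<And>n s. s \<in> K (m n) \<Longrightarrow> hnorm H (D s (S (Suc n) \<ominus> S n)) \<le> \<eta> n / 4\<close>[OF s] DS[OF s]
      by (simp add: hdist_def bounded_linear_on_minus[OF D[OF s] S S])
    moreover have "\<eta> (Suc k) \<le> \<eta> k / 2"
      using \<open>\<And>n. \<eta> (Suc n) \<le> \<eta> n / 2\<close> .
    moreover have "hdist H (D s (S (Suc k))) (D s (S n))
        \<le> hdist H (D s (S (Suc k))) (D s (S k)) + hdist H (D s (S k)) (D s (S n))"
      using DS[OF s] by (intro triangle)
    ultimately show ?case using step.IH step.prems by simp
  qed
  have close: "hdist H (D s (S k)) (D s (S n)) \<le> \<eta> n / 2" if "n \<le> k" "s \<in> K (m n)" for s n k
    using tele[OF that] \<eta>(1)[of k] by simp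
  have "\<exists>l. limitin mtopology (\<lambda>k. D s (S k)) l sequentially" if s: "s \<in> K n" for s n
  proof -
    have "MCauchy (\<lambda>k. D s (S k))"
      unfolding MCauchy_def
    proof (intro conjI allI impI)
      show "range (\<lambda>k. D s (S k)) \<subseteq> carrier H" using DS[OF s] by blast
      fix e :: real assume "e > 0"
      then obtain j where j: "(1/2)^j < e" using real_arch_pow_inv[of e "1/2"] by auto
      define N where "N = max n j"
      have sN: "s \<in> K (m N)" using s incseqD[OF K, of n "m N"] nm[of N] by (auto simp: N_def)
      have "(1/2::real)^N \<le> (1/2)^j" by (rule power_decreasing) (auto simp: N_def)
      then have "\<eta> N < e" using \<eta>(2)[of N] j by linarith
      then have "hdist H (D s (S k)) (D s (S k')) < e" if "N \<le> k" "N \<le> k'" for k k'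
        using close[OF that(1) sN] close[OF that(2) sN] commute[of "D s (S k')" "D s (S N)"]
          triangle[of "D s (S k)" "D s (S N)" "D s (S k')"] DS[OF s] by simp
      then show "\<exists>N. \<forall>k k'. N \<le> k \<longrightarrow> N \<le> k' \<longrightarrow> hdist H (D s (S k)) (D s (S k')) < e" by blast
    qed
    then show ?thesis using complete unfolding mcomplete_def by blast
  qed
  then obtain b where b: "\<And>s n. s \<in> K n \<Longrightarrow> limitin mtopology (\<lambda>k. D s (S k)) (b s) sequentially"
    by metis
  have bH: "b s \<in> carrier H" if "s \<in> K n" for s n
    using b[OF that] limitin_mspace by blast
  \<comment> \<open>The bound in \<open>close\<close> does not depend on the later index, so it
    survives letting that index tend to infinity.\<close>
  have lim: "hdist H (D s (S n)) (b s) \<le> \<eta> n / 2" if s: "s \<in> K (m n)" for s n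
  proof (rule LIMSEQ_le_const)
    have "(\<lambda>k. hdist H (D s (S k)) (b s)) \<longlonglongrightarrow> 0"
      using b[OF s] unfolding limitin_metric_dist_null by simp
    from tendsto_add[OF tendsto_const this, of "\<eta> n / 2"]
    show "(\<lambda>k. \<eta> n / 2 + hdist H (D s (S k)) (b s)) \<longlonglongrightarrow> \<eta> n / 2" by simp
    have "hdist H (D s (S n)) (b s) \<le> \<eta> n / 2 + hdist H (D s (S k)) (b s)" if "k \<ge> n" for k
      using close[OF that s] triangle[of "D s (S n)" "D s (S k)" "b s"] DS[OF s] bH[OF s]
      by (simp add: commute)
    then show "\<exists>N. \<forall>k\<ge>N. hdist H (D s (S n)) (b s) \<le> \<eta> n / 2 + hdist H (D s (S k)) (b s)" by blast
  qed
  show thesis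
  proof (rule that)
    show "range S \<subseteq> carrier H" using S by blast
    show "limitin mtopology (\<lambda>k. D s (S k)) (b s) sequentially" if "s \<in> K n" for s n
      using b[OF that] .
    show "\<exists>k. \<forall>s\<in>K n. hdist H (D s (S k)) (b s) < \<epsilon>" if e: "0 < \<epsilon>" for n \<epsilon>
    proof -
      obtain j where j: "(1/2)^j < \<epsilon>" using real_arch_pow_inv[of \<epsilon> "1/2"] e by auto
      let ?k = "max n j"
      have "(1/2::real)^?k \<le> (1/2)^j" by (rule power_decreasing) auto
      then have "\<eta> ?k < \<epsilon>" using \<eta>(2)[of ?k] j by linarith
      moreover have "K n \<subseteq> K (m ?k)" using incseqD[OF K, of n "m ?k"] nm[of ?k] by simp
      ultimately have "\<forall>s\<in>K n. hdist H (D s (S ?k)) (b s) < \<epsilon>"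
        using lim[of _ ?k] \<eta>(1)[of ?k] by fastforce
      then show ?thesis by blast
    qed
    show "\<exists>n. \<exists>s\<in>K n. b s \<noteq> D s x" if x: "x \<in> carrier H" for x
    proof -
      \<comment> \<open>At a stage \<open>n\<close> above the norm of \<open>x\<close>, equality of
        \<open>b\<close> and the image of \<open>x\<close> on \<open>K (m n)\<close> would put the
        image of \<open>S n\<close> within \<open>\<eta> n / 2\<close> of that of \<open>x\<close>,
        contradicting the gap \<open>\<eta> n\<close>.\<close>
      obtain n where n: "hnorm H x \<le> real n" using real_arch_simple by blast
      then obtain s where s: "s \<in> K (m n)" and far: "\<eta> n \<le> hnorm H (D s (S n \<ominus> x))"
        using gap[of n] x unfolding gap_def by blast
      have "hnorm H (D s (S n \<ominus> x)) = hdist H (D s (S n)) (D s x)"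
        using DS[OF s] D[OF s] x S by (simp add: hdist_def bounded_linear_on_minus)
      then have "b s \<noteq> D s x" using far lim[OF s] \<eta>(1)[of n] by auto
      then show ?thesis using s by blast
    qed
  qed
qed

end


section \<open>From almost invariant vectors to an affine action without fixed points\<close>

theorem proposition5p2:
  fixes G :: "('g, 'm) monoid_scheme" and T :: "'g topology" and c :: real
  assumes "locally_compact_group G T"
    and "sigma_compact_space T"
    and "c \<ge> 1"
    and "property_FH TYPE('h) c G T"
  shows "property_T TYPE('h) c G T"
  unfolding property_T_def
proof (intro allI impI ballI)
  fix H :: "'h hilbert" and \<pi>
  assume "hilbert_space H" and \<pi>: "\<pi> \<in> unif_bounded_reps c G T H"
    and almost: "almost_has_invariant_vectors T H \<pi>"
  interpret G: locally_compact_group G T by fact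
  interpret H: hilbert_space H by fact
  have rep: "strongly_continuous_rep G T H \<pi>"
    using \<pi> by (simp add: unif_bounded_reps_def)
  have op: "\<pi> s \<in> carrier (bounded_operators H)" if "s \<in> carrier G" for s
    using rep that
    by (auto simp: strongly_continuous_rep_def hom_def units_of_def Units_def)
  have lin: "H.bounded_linear_on (\<pi> s)" if "s \<in> carrier G" for s
    using op[OF that] by (rule H.bounded_operator_imp_bounded_linear_on)
  have mult: "\<pi> (s \<otimes>\<^bsub>G\<^esub> t) x = \<pi> s (\<pi> t x)"
    if "s \<in> carrier G" "t \<in> carrier G" "x \<in> carrier H" for s t x
    using rep that
    by (simp add: strongly_continuous_rep_def hom_def units_of_def bounded_operators_def compose_def)
  have cont: "continuous_map T (htopology H) (\<lambda>s. \<pi> s x)" if "x \<in> carrier H" for x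
    using rep that by (simp add: strongly_continuous_rep_def)
  obtain K :: "nat \<Rightarrow> 'g set" where K: "incseq K" "\<And>n. compactin T (K n)"
    and nhd: "\<And>s. s \<in> carrier G \<Longrightarrow> \<exists>n U. openin T U \<and> s \<in> U \<and> U \<subseteq> K n"
    using compact_exhaustion[OF G.locally_compact G.Hausdorff assms(2)] G.topspace_eq by metis
  have KG: "K n \<subseteq> carrier G" for n
    using compactin_subset_topspace[OF K(2)] G.topspace_eq by simp
  define D where "D s x = \<pi> s x \<ominus>\<^bsub>H\<^esub> x" for s x
  have D: "H.bounded_linear_on (D s)" if "s \<in> carrier G" for s
    unfolding D_def using H.bounded_linear_on_minus_id[OF lin[OF that]] .
  show "has_nonzero_invariant_vector G H \<pi>"
  proof (rule ccontr)
    assume no: "\<not> has_nonzero_invariant_vector G H \<pi>"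
    \<comment> \<open>The sets \<open>K n\<close> cover the group, so a vector killed by every
      \<open>D s\<close> is invariant and hence zero by assumption.\<close>
    have inj: "x = \<zero>\<^bsub>H\<^esub>" if x: "x \<in> carrier H" and D0: "\<And>n s. s \<in> K n \<Longrightarrow> D s x = \<zero>\<^bsub>H\<^esub>" for x
    proof -
      have "\<pi> s x = x" if s: "s \<in> carrier G" for s
      proof -
        have px: "\<pi> s x \<in> carrier H" using lin[OF s] x by simp
        have "\<pi> s x \<ominus>\<^bsub>H\<^esub> x = \<zero>\<^bsub>H\<^esub>" using D0 nhd[OF s] unfolding D_def by blast
        then have "hdist H (\<pi> s x) x = 0"
          using px x H.hnorm_eq_0_iff[of "\<zero>\<^bsub>H\<^esub>"] by (simp add: hdist_def)
        then show ?thesis using H.zero[OF px x] by simp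
      qed
      then show ?thesis using no x unfolding has_nonzero_invariant_vector_def by blast
    qed
    have small: "\<exists>\<xi>\<in>carrier H. 0 < hnorm H \<xi> \<and> (\<forall>s\<in>K n. hnorm H (D s \<xi>) \<le> \<epsilon> * hnorm H \<xi>)"
      if e: "0 < \<epsilon>" for n \<epsilon>
    proof -
      obtain \<xi> where \<xi>: "\<xi> \<in> carrier H"
        and less: "(SUP s\<in>K n. ennreal (hnorm H (D s \<xi>))) < ennreal (\<epsilon> * hnorm H \<xi>)"
        using almost K(2)[of n] e unfolding almost_has_invariant_vectors_def D_def by blast
      \<comment> \<open>The strict inequality in almost invariance is what excludes the zero
        vector.\<close>
      have "0 < ennreal (\<epsilon> * hnorm H \<xi>)" using less by (metis not_less_zero zero_less_iff_neq_zero)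
      then have pos: "0 < hnorm H \<xi>"
        using e by (simp add: zero_less_mult_iff)
      have "hnorm H (D s \<xi>) \<le> \<epsilon> * hnorm H \<xi>" if s: "s \<in> K n" for s
      proof -
        have "ennreal (hnorm H (D s \<xi>)) \<le> ennreal (\<epsilon> * hnorm H \<xi>)"
          using less s by (meson SUP_upper less_imp_le order_trans)
        then show ?thesis using e pos by (simp add: ennreal_le_iff)
      qed
      then show ?thesis using \<xi> pos by blast
    qed
    obtain S b where S: "range S \<subseteq> carrier H"
      and lim: "\<And>n s. s \<in> K n \<Longrightarrow> limitin (htopology H) (\<lambda>k. D s (S k)) (b s) sequentially"
      and unif: "\<And>n \<epsilon>. 0 < \<epsilon> \<Longrightarrow> \<exists>k. \<forall>s\<in>K n. hdist H (D s (S k)) (b s) < \<epsilon>"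
      and outside: "\<And>x. x \<in> carrier H \<Longrightarrow> \<exists>n. \<exists>s\<in>K n. b s \<noteq> D s x"
    proof (rule H.limit_outside_range[of K D])
      show "H.bounded_linear_on (D s)" if "s \<in> K n" for s n using D KG that by blast
    qed (use K inj small in auto)
    have limG: "limitin (htopology H) (\<lambda>k. D s (S k)) (b s) sequentially" if "s \<in> carrier G" for s
      using nhd[OF that] lim by blast
    have bH: "b s \<in> carrier H" if "s \<in> carrier G" for s
      using limG[OF that] H.limitin_mspace by blast
    have SH: "S k \<in> carrier H" for k using S by auto
    \<comment> \<open>Every orbit map minus its base vector is continuous, and interior points of
      the \<open>K n\<close> turn the uniform estimates into locally uniform ones.\<close>
    have "continuous_map T (htopology H) b"
    proof (rule H.continuous_map_locally_uniform_limit)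
      show "continuous_map T (htopology H) (\<lambda>s. D s (S k))" for k
        unfolding D_def using H.continuous_map_minus_const[OF cont[OF SH] SH] .
      show "b \<in> topspace T \<rightarrow> carrier H" using bH G.topspace_eq by auto
      show "\<exists>U. openin T U \<and> s \<in> U \<and> (\<forall>\<epsilon>>0. \<exists>k. \<forall>y\<in>U. hdist H (D y (S k)) (b y) < \<epsilon>)"
        if "s \<in> topspace T" for s
        using nhd[of s] that unif unfolding G.topspace_eq by (meson subsetD)
    qed
    moreover have "b (s \<otimes>\<^bsub>G\<^esub> t) = \<pi> s (b t) \<oplus>\<^bsub>H\<^esub> b s" if s: "s \<in> carrier G" and t: "t \<in> carrier G" for s t
    proof -
      have st: "s \<otimes>\<^bsub>G\<^esub> t \<in> carrier G" using s t by simp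
      have DS: "D u (S k) \<in> carrier H" if "u \<in> carrier G" for u k using D[OF that] SH by simp
      \<comment> \<open>Coboundaries satisfy the cocycle identity exactly. Continuity of addition
        and of the operator at \<open>s\<close>, with uniqueness of limits, carries it over to
        \<open>b\<close>.\<close>
      have "D (s \<otimes>\<^bsub>G\<^esub> t) (S k) = \<pi> s (D t (S k)) \<oplus>\<^bsub>H\<^esub> D s (S k)" for k
      proof -
        have c: "\<pi> t (S k) \<in> carrier H" "\<pi> s (S k) \<in> carrier H" "\<pi> s (\<pi> t (S k)) \<in> carrier H"
          using lin[OF s] lin[OF t] SH by simp_all
        have "\<pi> s (D t (S k)) = \<pi> s (\<pi> t (S k)) \<ominus>\<^bsub>H\<^esub> \<pi> s (S k)"
          unfolding D_def using H.bounded_linear_on_minus[OF lin[OF s] c(1) SH] .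
        then show ?thesis
          using c SH[of k] mult[OF s t SH]
          by (simp add: D_def a_minus_def H.a_ac H.r_neg1 H.r_neg2)
      qed
      moreover have "limitin (htopology H) (\<lambda>k. \<pi> s (D t (S k)) \<oplus>\<^bsub>H\<^esub> D s (S k)) (\<pi> s (b t) \<oplus>\<^bsub>H\<^esub> b s) sequentially"
        using DS s t lin[OF s]
        by (intro H.limitin_add[OF _ H.bounded_linear_on_limitin[OF lin[OF s] _ limG[OF t]] _ limG[OF s]])
          auto
      ultimately show ?thesis
        using H.limitin_metric_unique[OF limG[OF st]] by simp
    qed
    ultimately have "affine_action G T H \<pi> (\<lambda>s x. \<pi> s x \<oplus>\<^bsub>H\<^esub> b s)"
      unfolding affine_action_def using rep by blast
    then obtain x where x: "x \<in> carrier H" and fixed: "\<And>s. s \<in> carrier G \<Longrightarrow> \<pi> s x \<oplus>\<^bsub>H\<^esub> b s = x"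
      using assms(4)[unfolded property_FH_def, rule_format, OF \<open>hilbert_space H\<close> \<pi>] by blast
    \<comment> \<open>A fixed point \<open>x\<close> makes \<open>b\<close> the coboundary of
      \<open>-x\<close>, since \<open>b s = x - \<pi> s x\<close>; but \<open>b\<close> was built to
      differ from every coboundary.\<close>
    have "b s = D s (\<ominus>\<^bsub>H\<^esub> x)" if s: "s \<in> carrier G" for s
    proof -
      have px: "\<pi> s x \<in> carrier H" and p0: "\<pi> s \<zero>\<^bsub>H\<^esub> \<in> carrier H" using lin[OF s] x by simp_all
      have "\<pi> s (\<ominus>\<^bsub>H\<^esub> x) = \<ominus>\<^bsub>H\<^esub> \<pi> s x"
      proof -
        have z: "\<pi> s \<zero>\<^bsub>H\<^esub> = \<zero>\<^bsub>H\<^esub>"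
          using H.bounded_linear_on_minus[OF lin[OF s] x x] px x by (simp add: a_minus_def H.r_neg)
        show ?thesis
          using H.bounded_linear_on_minus[OF lin[OF s] H.zero_closed x] px x z by (simp add: a_minus_def)
      qed
      moreover have "b s = \<ominus>\<^bsub>H\<^esub> \<pi> s x \<oplus>\<^bsub>H\<^esub> x"
        using fixed[OF s] px bH[OF s] x by (metis H.r_neg1)
      ultimately show ?thesis using x px by (simp add: D_def a_minus_def)
    qed
    then show False using outside[of "\<ominus>\<^bsub>H\<^esub> x"] x KG by blast
  qed
qed

end
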